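(* Let $S$ be a set of variables of $R_m$. Then $S$ is a facet of $\mathcal{T}_m$ if and only if one of the following holds: (i) $z_1\in S$, $z_2\notin S$, and there is $j\in[m]$ with $S\cap V(e_j)=\{\overrightarrow{y}_j,z_{e_j}\}$ while for each $k\ne j$, $S\cap V(e_k)$ is a single variable, lying in $\{t_k,z_{e_k}\}$ if $k<j$ and in $\{t_k,\overrightarrow{y}_k\}$ if $k>j$; (ii) $z_2\in S$, $z_1\notin S$, and there is $j\in[m]$ with $S\cap V(e_j)=\{\overleftarrow{y}_j,z_{e_j}\}$ while for each $k\ne j$, $S\cap V(e_k)$ is a single variable, lying in $\{t_k,\overleftarrow{y}_k\}$ if $k<j$ and in $\{t_k,z_{e_k}\}$ if $k>j$; (iii) $z_1,z_2\in S$ and for every $k\in[m]$, $S\cap V(e_k)$ is a single variable lying in $\{z_{e_k},t_k\}$.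
   Context: Let $m\ge1$ and let $I_m$ be the graph on $\{1,2\}$ with exactly $m$ parallel edges $e_1,\ldots,e_m$ between $1$ and $2$. Its cosmological polytope $\mathcal{C}_{I_m}\subset\mathbb{R}^{\{1,2\}\cup\{e_1,\ldots,e_m\}}$ is the convex hull of $\mathbf{e}_1+\mathbf{e}_2-\mathbf{e}_{e_i}$, $\mathbf{e}_1-\mathbf{e}_2+\mathbf{e}_{e_i}$, $-\mathbf{e}_1+\mathbf{e}_2+\mathbf{e}_{e_i}$ ($i\in[m]$), of dimension $m+1$. Let $R_m$ be the polynomial ring over a field in the variables $z_1,z_2$ (for $\mathbf{e}_1,\mathbf{e}_2$), and for each $i$: $z_{e_i}$ (for $\mathbf{e}_{e_i}$), $t_i$ (for $\mathbf{e}_1+\mathbf{e}_2-\mathbf{e}_{e_i}$), $\overrightarrow{y}_i$ (for $\mathbf{e}_1-\mathbf{e}_2+\mathbf{e}_{e_i}$), $\overleftarrow{y}_i$ (for $-\mathbf{e}_1+\mathbf{e}_2+\mathbf{e}_{e_i}$); $V(e_i)=\{\overrightarrow{y}_i,\overleftarrow{y}_i,t_i,z_{e_i}\}$. Let $<$ be the lexicographic term order induced by $\overrightarrow{y}_1>\cdots>\overrightarrow{y}_m>\overleftarrow{y}_m>\cdots>\overleftarrow{y}_1>z_{e_1}>\cdots>z_{e_m}>t_1>\cdots>t_m>z_1>z_2$. Let $B$ be the set of binomials consisting of, for each $i$: $\overrightarrow{y}_i\overleftarrow{y}_i-z_{e_i}^2$, $\overrightarrow{y}_it_i-z_1^2$,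 $\overleftarrow{y}_it_i-z_2^2$, $\overrightarrow{y}_iz_2-z_1z_{e_i}$, $\overleftarrow{y}_iz_1-z_2z_{e_i}$, $t_iz_{e_i}-z_1z_2$; and, for each $i\ne k$: $\overrightarrow{y}_i\overleftarrow{y}_k-z_{e_i}z_{e_k}$, $\overrightarrow{y}_iz_{e_k}-\overrightarrow{y}_kz_{e_i}$, $\overleftarrow{y}_iz_{e_k}-\overleftarrow{y}_kz_{e_i}$. A facet of $\mathcal{T}_m$ is a set $S$ of $m+2$ variables that does not contain all variables of the $<$-leading monomial of any binomial in $B$ (the corresponding simplices form a unimodular triangulation $\mathcal{T}_m$ of $\mathcal{C}_{I_m}$). *)

theory Defs
  imports Main "HOL-Library.Poly_Mapping"
begin

text \<open>
  The variables of \<open>R\<^sub>m\<close>; the edge indices range over \<open>{1..m}\<close>, a bound imposed by \<open>var_list\<close>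
  below and not by the type. Each variable stands for a lattice point of the cosmological polytope:
  \<open>YR i\<close> (right arrow) for \<open>e\<^sub>1 - e\<^sub>2 + e\<^bsub>e\<^sub>i\<^esub>\<close>, \<open>YL i\<close> (left arrow) for \<open>- e\<^sub>1 + e\<^sub>2 + e\<^bsub>e\<^sub>i\<^esub>\<close>,
  \<open>ZE i\<close> for \<open>e\<^bsub>e\<^sub>i\<^esub>\<close>, \<open>T i\<close> for \<open>e\<^sub>1 + e\<^sub>2 - e\<^bsub>e\<^sub>i\<^esub>\<close>, and \<open>Z1\<close>, \<open>Z2\<close> for \<open>e\<^sub>1\<close>, \<open>e\<^sub>2\<close>.
\<close>

datatype var = YR nat | YL nat | ZE nat | T nat | Z1 | Z2

text \<open>The variables of \<open>R\<^sub>m\<close> from the largest to the smallest; note that the \<open>YL\<close> run backwards.\<close>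

definition var_list :: "nat \<Rightarrow> var list" where
  "var_list m =
     map YR [1..<Suc m] @ map YL (rev [1..<Suc m]) @
     map ZE [1..<Suc m] @ map T [1..<Suc m] @ [Z1, Z2]"

definition vars :: "nat \<Rightarrow> var set" where
  "vars m = set (var_list m)"

definition V :: "nat \<Rightarrow> var set" where
  "V i = {YR i, YL i, T i, ZE i}"

type_synonym monom = "var \<Rightarrow>\<^sub>0 nat"
type_synonym 'k mpol = "monom \<Rightarrow>\<^sub>0 'k"

definition X :: "var \<Rightarrow> 'k::field mpol" where
  "X x = Poly_Mapping.single (Poly_Mapping.single x 1) 1"

definition lex_less :: "nat \<Rightarrow> monom \<Rightarrow> monom \<Rightarrow> bool" where
  "lex_less m u v \<longleftrightarrow>
     (\<exists>p < length (var_list m).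
        Poly_Mapping.lookup u (var_list m ! p) < Poly_Mapping.lookup v (var_list m ! p) \<and>
        (\<forall>q < p. Poly_Mapping.lookup u (var_list m ! q) = Poly_Mapping.lookup v (var_list m ! q)))"

text \<open>Meaningful for nonzero \<open>f\<close> involving only variables in \<open>vars m\<close>.\<close>

definition leading_monom :: "nat \<Rightarrow> 'k::field mpol \<Rightarrow> monom" where
  "leading_monom m f =
     (THE u. u \<in> Poly_Mapping.keys f \<and>
             (\<forall>v \<in> Poly_Mapping.keys f. v \<noteq> u \<longrightarrow> lex_less m v u))"

definition binomials :: "nat \<Rightarrow> 'k::field mpol set" where
  "binomials m =
     (\<Union>i \<in> {1..m}.
        {X (YR i) * X (YL i) - X (ZE i) ^ 2,
         X (YR i) * X (T i) - X Z1 ^ 2,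
         X (YL i) * X (T i) - X Z2 ^ 2,
         X (YR i) * X Z2 - X Z1 * X (ZE i),
         X (YL i) * X Z1 - X Z2 * X (ZE i),
         X (T i) * X (ZE i) - X Z1 * X Z2}) \<union>
     (\<Union>i \<in> {1..m}. \<Union>k \<in> {1..m} - {i}.
        {X (YR i) * X (YL k) - X (ZE i) * X (ZE k),
         X (YR i) * X (ZE k) - X (YR k) * X (ZE i),
         X (YL i) * X (ZE k) - X (YL k) * X (ZE i)})"

text \<open>
  The facets of \<open>\<T>\<^sub>m\<close>, as sets of variables. The set of variables occurring in a monomial
  \<open>u\<close> is \<open>Poly_Mapping.keys u\<close>. The type argument is the coefficient field.
\<close>

definition is_facet :: "'k::field itself \<Rightarrow> nat \<Rightarrow> var set \<Rightarrow> bool" where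
  "is_facet _ m S \<longleftrightarrow>
     S \<subseteq> vars m \<and> card S = m + 2 \<and>
     (\<forall>f \<in> (binomials m :: 'k mpol set). \<not> Poly_Mapping.keys (leading_monom m f) \<subseteq> S)"

end

theory Submission
  imports Defs
begin

text \<open>
  The leading monomials of the binomials are products of two distinct variables, so faces are the
  stable sets of a graph on the variables. Such a set meets every block \<open>V k\<close> in at most
  two variables, and at most one block in exactly two, a pair \<open>{YR j, ZE j}\<close> or \<open>{YL j, ZE j}\<close>;
  such a pair excludes \<open>Z2\<close> respectively \<open>Z1\<close>. Counting to \<open>m + 2\<close>, either both of
  \<open>Z1\<close>, \<open>Z2\<close> occur and every block is met once, or exactly one of them occurs, together with one
  exceptional block.
\<close>

section \<open>Lexicographic comparison of monomials by positions of variables\<close>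

text \<open>The position of a variable of \<open>R\<^sub>m\<close> in \<open>var_list m\<close>, counted from 1.\<close>

fun rank :: "nat \<Rightarrow> var \<Rightarrow> nat" where
  "rank m (YR i) = i"
| "rank m (YL i) = 2 * m + 1 - i"
| "rank m (ZE i) = 2 * m + i"
| "rank m (T i) = 3 * m + i"
| "rank m Z1 = 4 * m + 1"
| "rank m Z2 = 4 * m + 2"

lemma sorted_wrt_rank_var_list: "sorted_wrt (\<lambda>x y. rank m x < rank m y) (var_list m)"
proof -
  have "sorted_wrt (<) [1..<Suc m]"
    by (rule sorted_wrt_upt)
  \<comment> \<open>Reversing the list swaps the two arguments. The indices are at most
    \<open>m\<close>, so the truncated subtraction is exact and strictly decreasing.\<close>
  moreover have "sorted_wrt (\<lambda>i k. 2 * m + 1 - i < 2 * m + 1 - k) (rev [1..<Suc m])"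
    unfolding sorted_wrt_rev by (rule sorted_wrt_mono_rel [OF _ sorted_wrt_upt]) auto
  ultimately show ?thesis
    unfolding var_list_def by (auto simp: sorted_wrt_append sorted_wrt_map simp del: upt_Suc)
qed

lemma vars_eq: "vars m = YR ` {1..m} \<union> YL ` {1..m} \<union> ZE ` {1..m} \<union> T ` {1..m} \<union> {Z1, Z2}"
  by (auto simp: vars_def var_list_def)

text \<open>The variable \<open>a\<close> is the largest one in \<open>u\<close> and exceeds every
  variable of \<open>v\<close>. All positions before that of \<open>a\<close> therefore carry
  exponent 0 in both monomials, and at \<open>a\<close> only \<open>u\<close> has a positive
  exponent.\<close>

lemma lex_less_if_rank_less:
  assumes "a \<in> Poly_Mapping.keys u" "a \<in> vars m"
    and u: "\<And>x. x \<in> Poly_Mapping.keys u \<Longrightarrow> rank m a \<le> rank m x"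
    and v: "\<And>x. x \<in> Poly_Mapping.keys v \<Longrightarrow> rank m a < rank m x"
  shows "lex_less m v u"
proof -
  obtain p where p: "p < length (var_list m)" "var_list m ! p = a"
    using assms(2) unfolding vars_def in_set_conv_nth by blast
  have "rank m (var_list m ! q) < rank m a" if "q < p" for q
    using sorted_wrt_nth_less [OF sorted_wrt_rank_var_list that p(1)] p(2) by simp
  then have "var_list m ! q \<notin> Poly_Mapping.keys u" "var_list m ! q \<notin> Poly_Mapping.keys v" if "q < p" for q
    using that u [of "var_list m ! q"] v [of "var_list m ! q"] by fastforce+
  then have "\<forall>q<p. Poly_Mapping.lookup v (var_list m ! q) = Poly_Mapping.lookup u (var_list m ! q)"
    unfolding in_keys_iff by simp
  moreover have "a \<notin> Poly_Mapping.keys v"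
    using v less_irrefl by iprover
  with assms(1) have "Poly_Mapping.lookup v (var_list m ! p) < Poly_Mapping.lookup u (var_list m ! p)"
    unfolding p(2) by (simp add: in_keys_iff)
  ultimately show ?thesis
    unfolding lex_less_def using p(1) by blast
qed

text \<open>The earlier of the two positions of first difference lies where the other comparison
  demands equality; if the positions coincide, the two strict inequalities clash.\<close>

lemma lex_less_asym: "lex_less m u v \<Longrightarrow> \<not> lex_less m v u"
  unfolding lex_less_def
proof clarify
  fix p q
  assume "Poly_Mapping.lookup u (var_list m ! p) < Poly_Mapping.lookup v (var_list m ! p)"
    "\<forall>r<p. Poly_Mapping.lookup u (var_list m ! r) = Poly_Mapping.lookup v (var_list m ! r)"
    "Poly_Mapping.lookup v (var_list m ! q) < Poly_Mapping.lookup u (var_list m ! q)"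
    "\<forall>r<q. Poly_Mapping.lookup v (var_list m ! r) = Poly_Mapping.lookup u (var_list m ! r)"
  then show False
    by (cases p q rule: linorder_cases) auto
qed

lemma leading_monomI:
  assumes "u \<in> Poly_Mapping.keys f" "\<And>v. v \<in> Poly_Mapping.keys f \<Longrightarrow> v \<noteq> u \<Longrightarrow> lex_less m v u"
  shows "leading_monom m f = u"
  unfolding leading_monom_def
proof (rule the_equality)
  show "u \<in> Poly_Mapping.keys f \<and> (\<forall>v \<in> Poly_Mapping.keys f. v \<noteq> u \<longrightarrow> lex_less m v u)"
    using assms by blast
next
  fix w
  assume w: "w \<in> Poly_Mapping.keys f \<and> (\<forall>v \<in> Poly_Mapping.keys f. v \<noteq> w \<longrightarrow> lex_less m v w)"
  show "w = u"
  proof (rule ccontr)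
    assume "w \<noteq> u"
    then have "lex_less m w u" "lex_less m u w"
      using w assms by auto
    then show False
      by (blast dest: lex_less_asym)
  qed
qed

section \<open>Leading monomials of differences of two quadratic monomials\<close>

lemma X_mult_X:
  "X a * X b =
    (Poly_Mapping.single (Poly_Mapping.single a 1 + Poly_Mapping.single b 1) 1 :: 'k::field mpol)"
  by (simp add: X_def mult_single)

lemma keys_single_add_single:
  "Poly_Mapping.keys (Poly_Mapping.single a 1 + Poly_Mapping.single b (1::nat)) = {a, b}"
  by (auto simp: in_keys_iff lookup_add lookup_single when_def split: if_splits)

lemma keys_single_diff_single:
  "u \<noteq> v \<Longrightarrow>
    Poly_Mapping.keys (Poly_Mapping.single u 1 - Poly_Mapping.single v (1::'k::field)) = {u, v}"
  by (auto simp: in_keys_iff lookup_minus lookup_single when_def split: if_splits)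

text \<open>The coefficients 1 and -1 are nonzero, so either order of subtraction leaves the same
  two monomials. Both orders are kept because some of the binomials have their leading term
  second.\<close>

lemma leading_monom_single_diff_single:
  assumes "lex_less m v u"
  shows "leading_monom m (Poly_Mapping.single u 1 - Poly_Mapping.single v (1::'k::field)) = u"
    and "leading_monom m (Poly_Mapping.single v 1 - Poly_Mapping.single u (1::'k)) = u"
proof -
  have "u \<noteq> v"
    using assms lex_less_asym by metis
  then show "leading_monom m (Poly_Mapping.single u 1 - Poly_Mapping.single v (1::'k)) = u"
    and "leading_monom m (Poly_Mapping.single v 1 - Poly_Mapping.single u (1::'k)) = u"
    using assms by (auto intro!: leading_monomI simp: keys_single_diff_single)
qed

text \<open>The smaller rank in a product belongs to its larger variable, so the hypothesis on
  minima says that one of \<open>a\<close>, \<open>b\<close> exceeds both \<open>c\<close> and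
  \<open>d\<close>. Squares are the case \<open>c = d\<close>.\<close>

lemma keys_leading_monom_binomial:
  fixes m :: nat
  assumes "a \<in> vars m" "b \<in> vars m"
    and "min (rank m a) (rank m b) < min (rank m c) (rank m d)"
  shows "Poly_Mapping.keys (leading_monom m (X a * X b - X c * X d :: 'k::field mpol)) = {a, b}"
    and "Poly_Mapping.keys (leading_monom m (X c * X d - X a * X b :: 'k mpol)) = {a, b}"
proof -
  let ?u = "Poly_Mapping.single a 1 + Poly_Mapping.single b (1::nat)"
  let ?v = "Poly_Mapping.single c 1 + Poly_Mapping.single d (1::nat)"
  define t where "t = (if rank m a \<le> rank m b then a else b)"
  have lex: "lex_less m ?v ?u"
    by (rule lex_less_if_rank_less [where a = t], unfold keys_single_add_single)
      (use assms in \<open>auto simp: t_def min_def split: if_splits\<close>)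
  show "Poly_Mapping.keys (leading_monom m (X a * X b - X c * X d :: 'k mpol)) = {a, b}"
    and "Poly_Mapping.keys (leading_monom m (X c * X d - X a * X b :: 'k mpol)) = {a, b}"
    unfolding X_mult_X leading_monom_single_diff_single [OF lex] by (fact keys_single_add_single)+
qed

section \<open>Faces as stable sets of a graph\<close>

text \<open>The forbidden pairs are the supports of the leading monomials. Indices are left
  unbounded, which changes nothing for subsets of \<open>vars m\<close>; the first clause joins the
  cases \<open>i = k\<close> and \<open>i \<noteq> k\<close>.\<close>

definition is_face :: "var set \<Rightarrow> bool" where
  "is_face S \<longleftrightarrow>
     (\<forall>i k. \<not> {YR i, YL k} \<subseteq> S) \<and>
     (\<forall>i. \<not> {YR i, T i} \<subseteq> S \<and> \<not> {YL i, T i} \<subseteq> S \<and> \<not> {T i, ZE i} \<subseteq> S) \<and>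
     (\<forall>i. \<not> {YR i, Z2} \<subseteq> S \<and> \<not> {YL i, Z1} \<subseteq> S) \<and>
     (\<forall>i k. i < k \<longrightarrow> \<not> {YR i, ZE k} \<subseteq> S \<and> \<not> {YL k, ZE i} \<subseteq> S)"

lemma binomials_iff_is_face:
  fixes m :: nat
  assumes "S \<subseteq> vars m"
  shows "(\<forall>f \<in> (binomials m :: 'k::field mpol set). \<not> Poly_Mapping.keys (leading_monom m f) \<subseteq> S) \<longleftrightarrow>
    is_face S"
proof -
  note lm = keys_leading_monom_binomial [where ?'k = 'k and m = m]
  let ?L = "\<lambda>f :: 'k mpol. Poly_Mapping.keys (leading_monom m f)"
  \<comment> \<open>In each of these six binomials the first product contains the largest variable:
    an arrow in five of them, \<open>ZE i\<close> in the last, while the second product has no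
    arrow.\<close>
  have diag:
    "?L (X (YR i) * X (YL i) - X (ZE i) ^ 2) = {YR i, YL i}"
    "?L (X (YR i) * X (T i) - X Z1 ^ 2) = {YR i, T i}"
    "?L (X (YL i) * X (T i) - X Z2 ^ 2) = {YL i, T i}"
    "?L (X (YR i) * X Z2 - X Z1 * X (ZE i)) = {YR i, Z2}"
    "?L (X (YL i) * X Z1 - X Z2 * X (ZE i)) = {YL i, Z1}"
    "?L (X (T i) * X (ZE i) - X Z1 * X Z2) = {T i, ZE i}"
    if "i \<in> {1..m}" for i
    unfolding power2_eq_square using that by (intro lm; auto simp: vars_eq)+
  \<comment> \<open>For \<open>i < k\<close> the larger arrow is \<open>YR i\<close> on the right
    but \<open>YL k\<close> on the left, since the \<open>YL\<close> are ordered backwards. Each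
    binomial is needed with both signs, as the defining union runs over ordered pairs of
    indices.\<close>
  have swap:
    "?L (X (YR i) * X (ZE k) - X (YR k) * X (ZE i)) = {YR i, ZE k}"
    "?L (X (YR k) * X (ZE i) - X (YR i) * X (ZE k)) = {YR i, ZE k}"
    "?L (X (YL k) * X (ZE i) - X (YL i) * X (ZE k)) = {YL k, ZE i}"
    "?L (X (YL i) * X (ZE k) - X (YL k) * X (ZE i)) = {YL k, ZE i}"
    if "1 \<le> i" "i < k" "k \<le> m" for i k
    using that by (intro lm; auto simp: vars_eq)+
  have offdiag:
    "?L (X (YR i) * X (YL k) - X (ZE i) * X (ZE k)) = {YR i, YL k}"
    "?L (X (YR i) * X (ZE k) - X (YR k) * X (ZE i)) =
      (if i < k then {YR i, ZE k} else {YR k, ZE i})"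
    "?L (X (YL i) * X (ZE k) - X (YL k) * X (ZE i)) =
      (if i < k then {YL k, ZE i} else {YL i, ZE k})"
    if "i \<in> {1..m}" "k \<in> {1..m} - {i}" for i k
  proof -
    show "?L (X (YR i) * X (YL k) - X (ZE i) * X (ZE k)) = {YR i, YL k}"
      using that by (intro lm) (auto simp: vars_eq)
    have ik: "1 \<le> i \<and> i < k \<and> k \<le> m \<or> 1 \<le> k \<and> k < i \<and> i \<le> m"
      using that by auto
    show "?L (X (YR i) * X (ZE k) - X (YR k) * X (ZE i)) =
        (if i < k then {YR i, ZE k} else {YR k, ZE i})"
      using ik by (elim disjE) (simp_all add: swap)
    show "?L (X (YL i) * X (ZE k) - X (YL k) * X (ZE i)) =
        (if i < k then {YL k, ZE i} else {YL i, ZE k})"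
      using ik by (elim disjE) (simp_all add: swap)
  qed
  \<comment> \<open>This turns the index bounds of \<open>binomials\<close> into the unbounded
    quantifiers of \<open>is_face\<close>.\<close>
  have range: "YR i \<in> S \<or> YL i \<in> S \<or> ZE i \<in> S \<or> T i \<in> S \<Longrightarrow> i \<in> {1..m}" for i
    using assms by (auto simp: vars_eq)
  have "(\<forall>f \<in> (binomials m :: 'k mpol set). \<not> ?L f \<subseteq> S) \<longleftrightarrow>
    (\<forall>i \<in> {1..m}. \<not> {YR i, YL i} \<subseteq> S \<and> \<not> {YR i, T i} \<subseteq> S \<and> \<not> {YL i, T i} \<subseteq> S \<and>
      \<not> {YR i, Z2} \<subseteq> S \<and> \<not> {YL i, Z1} \<subseteq> S \<and> \<not> {T i, ZE i} \<subseteq> S) \<and>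
    (\<forall>i \<in> {1..m}. \<forall>k \<in> {1..m} - {i}. \<not> {YR i, YL k} \<subseteq> S \<and>
      \<not> (if i < k then {YR i, ZE k} else {YR k, ZE i}) \<subseteq> S \<and>
      \<not> (if i < k then {YL k, ZE i} else {YL i, ZE k}) \<subseteq> S)"
    unfolding binomials_def
    by (simp add: ball_Un diag offdiag del: insert_subset Diff_iff atLeastAtMost_iff cong: ball_cong)
  also have "\<dots> \<longleftrightarrow> is_face S"
    (is "?A \<and> ?B \<longleftrightarrow> _")
  proof
    assume *: "?A \<and> ?B"
    note A = bspec [OF conjunct1 [OF *]] and B = bspec [OF bspec [OF conjunct2 [OF *]]]
    show "is_face S"
      unfolding is_face_def
    proof (intro conjI allI impI notI)
      fix i k
      \<comment> \<open>The diagonal pair comes from the binomials of a single edge, the others from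
        those of two edges.\<close>
      show False if "{YR i, YL k} \<subseteq> S"
        using that range [of i] range [of k] A [of i] B [of i k] by (cases "i = k") simp_all
      show False if "{YR i, T i} \<subseteq> S"
        using that range [of i] A [of i] by simp
      show False if "{YL i, T i} \<subseteq> S"
        using that range [of i] A [of i] by simp
      show False if "{T i, ZE i} \<subseteq> S"
        using that range [of i] A [of i] by simp
      show False if "{YR i, Z2} \<subseteq> S"
        using that range [of i] A [of i] by simp
      show False if "{YL i, Z1} \<subseteq> S"
        using that range [of i] A [of i] by simp
      show False if "i < k" "{YR i, ZE k} \<subseteq> S"
        using that range [of i] range [of k] B [of i k] by simp
      show False if "i < k" "{YL k, ZE i} \<subseteq> S"
        using that range [of i] range [of k] B [of i k] by simp
    qed
  next
    assume face: "is_face S"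
    then have ?A
      unfolding is_face_def by blast
    moreover have ?B
    proof (intro ballI)
      fix i k
      assume "k \<in> {1..m} - {i}"
      then have "i < k \<or> k < i" by auto
      moreover have "\<not> {YR i, YL k} \<subseteq> S" and "i < k \<Longrightarrow> \<not> {YR i, ZE k} \<subseteq> S \<and> \<not> {YL k, ZE i} \<subseteq> S"
        and "k < i \<Longrightarrow> \<not> {YR k, ZE i} \<subseteq> S \<and> \<not> {YL i, ZE k} \<subseteq> S"
        using face unfolding is_face_def by blast+
      ultimately show "\<not> {YR i, YL k} \<subseteq> S \<and>
        \<not> (if i < k then {YR i, ZE k} else {YR k, ZE i}) \<subseteq> S \<and>
        \<not> (if i < k then {YL k, ZE i} else {YL i, ZE k}) \<subseteq> S"
        by (elim disjE) simp_all
    qed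
    ultimately show "?A \<and> ?B" ..
  qed
  finally show ?thesis .
qed

section \<open>Counting variables block by block\<close>

lemma finite_vars: "finite (vars m)"
  by (simp add: vars_def)

lemma card_eq_sum_blocks:
  assumes "S \<subseteq> vars m"
  shows "card S = (\<Sum>k = 1..m. card (S \<inter> V k)) + of_bool (Z1 \<in> S) + of_bool (Z2 \<in> S)"
proof -
  have S: "S = (\<Union>k \<in> {1..m}. S \<inter> V k) \<union> (S \<inter> {Z1, Z2})"
    using assms by (auto simp: vars_eq V_def)
  have "finite S"
    using assms finite_vars finite_subset by blast
  then have "card S = card (\<Union>k \<in> {1..m}. S \<inter> V k) + card (S \<inter> {Z1, Z2})"
    by (subst S, subst card_Un_disjoint) (auto simp: V_def)
  moreover have "card (\<Union>k \<in> {1..m}. S \<inter> V k) = (\<Sum>k = 1..m. card (S \<inter> V k))"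
    using \<open>finite S\<close> by (intro card_UN_disjoint) (auto simp: V_def)
  moreover have "card (S \<inter> {Z1, Z2}) = of_bool (Z1 \<in> S) + of_bool (Z2 \<in> S)"
    by (simp add: Int_insert_right)
  ultimately show ?thesis
    by simp
qed

lemma card_block:
  "card (S \<inter> V k) =
    of_bool (YR k \<in> S) + of_bool (YL k \<in> S) + of_bool (T k \<in> S) + of_bool (ZE k \<in> S)"
  by (simp add: V_def Int_insert_right)

text \<open>Splits the singleton conditions of the theorem into a count and a membership condition,
  which are established by separate arguments.\<close>

lemma block_eq_singleton:
  "(\<exists>x. S \<inter> V k = {x} \<and> P x) \<longleftrightarrow> card (S \<inter> V k) = 1 \<and> (\<forall>x \<in> S \<inter> V k. P x)"
  unfolding One_nat_def card_1_singleton_iff by force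

section \<open>How a face can meet the blocks\<close>

lemma is_face_YR:
  "is_face S \<Longrightarrow> YR i \<in> S \<Longrightarrow> YL k \<notin> S \<and> T i \<notin> S \<and> Z2 \<notin> S \<and> (i < k \<longrightarrow> ZE k \<notin> S)"
  unfolding is_face_def by blast

text \<open>Mirror image of \<open>is_face_YR\<close>: exchanging the two vertices swaps
  \<open>YR\<close> with \<open>YL\<close> and \<open>Z1\<close> with \<open>Z2\<close>, and the
  backward order of the \<open>YL\<close> reverses the comparison of indices.\<close>

lemma is_face_YL:
  "is_face S \<Longrightarrow> YL i \<in> S \<Longrightarrow> YR k \<notin> S \<and> T i \<notin> S \<and> Z1 \<notin> S \<and> (k < i \<longrightarrow> ZE k \<notin> S)"
  unfolding is_face_def by blast

lemma is_face_T: "is_face S \<Longrightarrow> T i \<in> S \<Longrightarrow> ZE i \<notin> S"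
  by (simp add: is_face_def)

text \<open>Inside a block \<open>YR k\<close>, \<open>YL k\<close>, \<open>T k\<close> are pairwise
  adjacent, and \<open>T k\<close> is adjacent to \<open>ZE k\<close>. The only non-adjacent pairs
  are \<open>ZE k\<close> with one of the arrows, and there is no stable triple.\<close>

lemma card_block_ge_2:
  assumes "is_face S" "2 \<le> card (S \<inter> V k)"
  shows "ZE k \<in> S" "T k \<notin> S" "YR k \<in> S \<and> YL k \<notin> S \<or> YL k \<in> S \<and> YR k \<notin> S"
    "card (S \<inter> V k) = 2"
proof -
  have "YR k \<in> S \<longrightarrow> YL k \<notin> S \<and> T k \<notin> S" "YL k \<in> S \<longrightarrow> T k \<notin> S" "T k \<in> S \<longrightarrow> ZE k \<notin> S"
    using assms(1) is_face_YR is_face_YL is_face_T by blast+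
  then show "ZE k \<in> S" "T k \<notin> S" "YR k \<in> S \<and> YL k \<notin> S \<or> YL k \<in> S \<and> YR k \<notin> S"
    "card (S \<inter> V k) = 2"
    using assms(2) unfolding card_block by (simp_all add: of_bool_def split: if_splits)
qed

lemma sum_eq_card_imp_eq_1:
  fixes f :: "'a \<Rightarrow> nat"
  assumes "finite A" "sum f A = card A" "\<And>x. x \<in> A \<Longrightarrow> f x \<le> 1" "x \<in> A"
  shows "f x = 1"
  using sum_mono_inv [of f A "\<lambda>_. 1" x] assms by simp

text \<open>With at most one of \<open>Z1\<close>, \<open>Z2\<close> present, the \<open>m\<close>
  blocks hold at least \<open>m + 1\<close> variables, so some block holds two. It is the only such
  block, which bounds the total by \<open>m + 1\<close>; equality then forces all the remaining
  claims.\<close>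

lemma is_face_exceptional_block:
  assumes "is_face S" "card S = m + 2" "S \<subseteq> vars m" "\<not> (Z1 \<in> S \<and> Z2 \<in> S)"
  obtains j where "j \<in> {1..m}" "card (S \<inter> V j) = 2" "Z1 \<in> S \<or> Z2 \<in> S"
    "\<And>k. k \<in> {1..m} - {j} \<Longrightarrow> card (S \<inter> V k) = 1"
proof -
  let ?n = "\<lambda>k. card (S \<inter> V k)"
  have total: "m + 1 + of_bool (Z1 \<notin> S \<and> Z2 \<notin> S) = sum ?n {1..m}"
    using card_eq_sum_blocks [OF assms(3)] assms(2,4) by (auto split: if_splits)
  have "\<exists>j \<in> {1..m}. 2 \<le> ?n j"
  proof (rule ccontr)
    assume "\<not> ?thesis"
    then have "sum ?n {1..m} \<le> (\<Sum>k = 1..m. 1)"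
      by (intro sum_mono) force
    then show False
      using total by simp
  qed
  then obtain j where j: "j \<in> {1..m}" "2 \<le> ?n j" ..
  note nj = card_block_ge_2 [OF assms(1) j(2)]
  \<comment> \<open>Two blocks with two variables each would both contain an arrow and their
    \<open>ZE\<close>. Arrows of opposite direction are adjacent; for equal directions, the arrow of
    one block is adjacent to the \<open>ZE\<close> of the other.\<close>
  have le: "?n k \<le> 1" if "k \<in> {1..m} - {j}" for k
  proof (rule ccontr)
    assume "\<not> ?n k \<le> 1"
    then have nk: "2 \<le> ?n k" by simp
    note nk = card_block_ge_2 [OF assms(1) nk]
    have "k < j \<or> j < k" using that by auto
    then show False
      using nj(1,3) nk(1,3) is_face_YR [OF assms(1)] is_face_YL [OF assms(1)] by blast
  qed
  have rest: "sum ?n {1..m} = 2 + sum ?n ({1..m} - {j})"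
    using nj(4) j(1) by (simp add: sum.remove)
  moreover have "sum ?n ({1..m} - {j}) \<le> (\<Sum>k \<in> {1..m} - {j}. 1)"
    using le by (intro sum_mono) auto
  \<comment> \<open>The blocks hold at most 2 + (m - 1) variables, so the extra 1 in
    \<open>total\<close> must vanish.\<close>
  ultimately have Z: "Z1 \<in> S \<or> Z2 \<in> S"
    using total j(1) by (auto simp: of_bool_def split: if_splits)
  then have sum_rest: "sum ?n ({1..m} - {j}) = card ({1..m} - {j})"
    using total rest j(1) by auto
  have "?n k = 1" if "k \<in> {1..m} - {j}" for k
    by (rule sum_eq_card_imp_eq_1 [where f = ?n, OF _ sum_rest le that]) simp
  then show ?thesis
    using that j(1) nj(4) Z by blast
qed

section \<open>The three types of facets\<close>

theorem theorem4p12: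
  fixes m :: nat and S :: "var set"
  assumes "m \<ge> 1" and "S \<subseteq> vars m"
  shows "is_facet TYPE('k::field) m S \<longleftrightarrow>
    (Z1 \<in> S \<and> Z2 \<notin> S \<and>
      (\<exists>j \<in> {1..m}. S \<inter> V j = {YR j, ZE j} \<and>
        (\<forall>k \<in> {1..m} - {j}. \<exists>x. S \<inter> V k = {x} \<and>
          (k < j \<longrightarrow> x \<in> {T k, ZE k}) \<and> (k > j \<longrightarrow> x \<in> {T k, YR k})))) \<or>
    (Z2 \<in> S \<and> Z1 \<notin> S \<and>
      (\<exists>j \<in> {1..m}. S \<inter> V j = {YL j, ZE j} \<and>
        (\<forall>k \<in> {1..m} - {j}. \<exists>x. S \<inter> V k = {x} \<and>
          (k < j \<longrightarrow> x \<in> {T k, YL k}) \<and> (k > j \<longrightarrow> x \<in> {T k, ZE k})))) \<or>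
    (Z1 \<in> S \<and> Z2 \<in> S \<and>
      (\<forall>k \<in> {1..m}. \<exists>x. S \<inter> V k = {x} \<and> x \<in> {ZE k, T k}))"
proof -
  let ?i = "Z1 \<in> S \<and> Z2 \<notin> S \<and>
      (\<exists>j \<in> {1..m}. S \<inter> V j = {YR j, ZE j} \<and>
        (\<forall>k \<in> {1..m} - {j}. \<exists>x. S \<inter> V k = {x} \<and>
          (k < j \<longrightarrow> x \<in> {T k, ZE k}) \<and> (k > j \<longrightarrow> x \<in> {T k, YR k})))"
  let ?ii = "Z2 \<in> S \<and> Z1 \<notin> S \<and>
      (\<exists>j \<in> {1..m}. S \<inter> V j = {YL j, ZE j} \<and>
        (\<forall>k \<in> {1..m} - {j}. \<exists>x. S \<inter> V k = {x} \<and>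
          (k < j \<longrightarrow> x \<in> {T k, YL k}) \<and> (k > j \<longrightarrow> x \<in> {T k, ZE k})))"
  let ?iii = "Z1 \<in> S \<and> Z2 \<in> S \<and>
      (\<forall>k \<in> {1..m}. \<exists>x. S \<inter> V k = {x} \<and> x \<in> {ZE k, T k})"
  have facet: "is_facet TYPE('k) m S \<longleftrightarrow> card S = m + 2 \<and> is_face S"
    unfolding is_facet_def using assms(2) binomials_iff_is_face [OF assms(2), where ?'k = 'k] by simp
  have range: "YR i \<in> S \<or> YL i \<in> S \<or> ZE i \<in> S \<or> T i \<in> S \<Longrightarrow> i \<in> {1..m}" for i
    using assms(2) by (auto simp: vars_eq)
  have sum_block: "sum (\<lambda>k. card (S \<inter> V k)) {1..m} = m + 1"
    if "j \<in> {1..m}" "card (S \<inter> V j) = 2" "\<And>k. k \<in> {1..m} - {j} \<Longrightarrow> card (S \<inter> V k) = 1" for j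
    using that by (simp add: sum.remove [of _ j])
  have "?i \<or> ?ii \<or> ?iii" if S: "card S = m + 2" "is_face S"
  proof (cases "Z1 \<in> S \<and> Z2 \<in> S")
    case True
    \<comment> \<open>Every arrow is adjacent to \<open>Z1\<close> or to \<open>Z2\<close>. Without
      arrows each block holds at most one variable, and the \<open>m\<close> variables left to the
      blocks force exactly one in each.\<close>
    then have no: "YR k \<notin> S" "YL k \<notin> S" "T k \<notin> S \<or> ZE k \<notin> S" for k
      using True is_face_YR [OF S(2)] is_face_YL [OF S(2)] is_face_T [OF S(2)] by blast+
    have sum_one: "sum (\<lambda>k. card (S \<inter> V k)) {1..m} = card {1..m}"
      using card_eq_sum_blocks [OF assms(2)] S(1) True by simp
    have le: "card (S \<inter> V k) \<le> 1" for k
      using no [of k] by (auto simp: card_block)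
    have "card (S \<inter> V k) = 1" if "k \<in> {1..m}" for k
      by (rule sum_eq_card_imp_eq_1 [OF _ sum_one le that]) simp
    then have ?iii
      using True no unfolding block_eq_singleton by (auto simp: V_def)
    then show ?thesis by blast
  next
    case False
    then obtain j where j: "j \<in> {1..m}" "card (S \<inter> V j) = 2" "Z1 \<in> S \<or> Z2 \<in> S"
      "\<And>k. k \<in> {1..m} - {j} \<Longrightarrow> card (S \<inter> V k) = 1"
      using is_face_exceptional_block [OF S(2,1) assms(2)] by metis
    from j(3) show ?thesis
    proof
      assume Z: "Z1 \<in> S"
      \<comment> \<open>\<open>Z1\<close> rules out all left arrows, so the block with two variables
        is \<open>YR j\<close>, \<open>ZE j\<close>. Then \<open>ZE j\<close> excludes
        \<open>YR k\<close> for \<open>k < j\<close>, and \<open>YR j\<close> excludes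
        \<open>ZE k\<close> for \<open>k > j\<close>.\<close>
      have "YL k \<notin> S" for k
        using Z is_face_YL [OF S(2)] by blast
      moreover from this have Vj: "YR j \<in> S" "ZE j \<in> S" "T j \<notin> S"
        using card_block_ge_2 [OF S(2), of j] j(2) by auto
      moreover have "YR k \<notin> S" if "k < j" for k
        using that Vj is_face_YR [OF S(2)] is_face_YL [OF S(2)] by blast
      moreover have "ZE k \<notin> S" if "j < k" for k
        using that Vj is_face_YR [OF S(2)] is_face_YL [OF S(2)] by blast
      ultimately have ?i
        using Z False j(1,4) unfolding block_eq_singleton
        by (intro conjI bexI [of _ j]) (auto simp: V_def)
      then show ?thesis by blast
    next
      assume Z: "Z2 \<in> S"
      \<comment> \<open>Mirrored: here \<open>YL j\<close> excludes \<open>ZE k\<close> for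
        \<open>k < j\<close>, and \<open>ZE j\<close> excludes \<open>YL k\<close> for
        \<open>k > j\<close>.\<close>
      have "YR k \<notin> S" for k
        using Z is_face_YR [OF S(2)] by blast
      moreover from this have Vj: "YL j \<in> S" "ZE j \<in> S" "T j \<notin> S"
        using card_block_ge_2 [OF S(2), of j] j(2) by auto
      moreover have "ZE k \<notin> S" if "k < j" for k
        using that Vj is_face_YR [OF S(2)] is_face_YL [OF S(2)] by blast
      moreover have "YL k \<notin> S" if "j < k" for k
        using that Vj is_face_YR [OF S(2)] is_face_YL [OF S(2)] by blast
      ultimately have ?ii
        using Z False j(1,4) unfolding block_eq_singleton
        by (intro conjI bexI [of _ j]) (auto simp: V_def)
      then show ?thesis by blast
    qed
  qed
  moreover have "card S = m + 2 \<and> is_face S" if i: ?i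
  proof -
    obtain j where j: "j \<in> {1..m}" "S \<inter> V j = {YR j, ZE j}"
      and blocks: "\<And>k. k \<in> {1..m} - {j} \<Longrightarrow> \<exists>x. S \<inter> V k = {x} \<and>
        (k < j \<longrightarrow> x \<in> {T k, ZE k}) \<and> (k > j \<longrightarrow> x \<in> {T k, YR k})"
      using i by (elim conjE bexE) (rule that, assumption+, erule bspec)
    have one: "card (S \<inter> V k) = 1" if "k \<in> {1..m} - {j}" for k
      using blocks [OF that] unfolding block_eq_singleton ..
    have lo: "(k < j \<longrightarrow> x \<in> {T k, ZE k}) \<and> (k > j \<longrightarrow> x \<in> {T k, YR k})"
      if "k \<in> {1..m} - {j}" "x \<in> S \<inter> V k" for x k
      using blocks [OF that(1)] that(2) unfolding block_eq_singleton by blast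
    have two: "card (S \<inter> V j) = 2"
      using j(2) by simp
    have Vj: "YR j \<in> S" "ZE j \<in> S" "T j \<notin> S" "YL j \<notin> S"
      using j(2) by (auto simp: V_def)
    \<comment> \<open>Right arrows sit only at indices from \<open>j\<close> on and
      \<open>ZE\<close> only up to \<open>j\<close>, so no \<open>YR k\<close>, \<open>ZE l\<close>
      with \<open>k < l\<close> can occur together.\<close>
    have YR: "j \<le> k" if "YR k \<in> S" for k
      using that lo [of k "YR k"] range [of k]
      by (cases k j rule: linorder_cases) (simp_all add: V_def)
    have ZE: "k \<le> j" if "ZE k \<in> S" for k
      using that lo [of k "ZE k"] range [of k]
      by (cases k j rule: linorder_cases) (simp_all add: V_def)
    have YL: "YL k \<notin> S" for k
      using lo [of k "YL k"] range [of k] Vj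
      by (cases k j rule: linorder_cases) (auto simp: V_def)
    have T: "T k \<in> S \<Longrightarrow> YR k \<notin> S \<and> ZE k \<notin> S" for k
      using one [of k] range [of k] Vj by (cases "k = j") (auto simp: card_block)
    have "\<not> (YR k \<in> S \<and> ZE l \<in> S)" if "k < l" for k l
      using that YR [of k] ZE [of l] by linarith
    \<comment> \<open>The extracted conjunct is \<open>Z2 \<notin> S\<close>, which disposes of the
      pairs of \<open>Z2\<close> with a right arrow.\<close>
    then have "is_face S"
      unfolding is_face_def using conjunct1 [OF conjunct2 [OF i]] YL T by blast
    then show ?thesis
      using i sum_block [OF j(1) two one] card_eq_sum_blocks [OF assms(2)] by simp
  qed
  moreover have "card S = m + 2 \<and> is_face S" if ii: ?ii
  proof -
    obtain j where j: "j \<in> {1..m}" "S \<inter> V j = {YL j, ZE j}"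
      and blocks: "\<And>k. k \<in> {1..m} - {j} \<Longrightarrow> \<exists>x. S \<inter> V k = {x} \<and>
        (k < j \<longrightarrow> x \<in> {T k, YL k}) \<and> (k > j \<longrightarrow> x \<in> {T k, ZE k})"
      using ii by (elim conjE bexE) (rule that, assumption+, erule bspec)
    have one: "card (S \<inter> V k) = 1" if "k \<in> {1..m} - {j}" for k
      using blocks [OF that] unfolding block_eq_singleton ..
    have lo: "(k < j \<longrightarrow> x \<in> {T k, YL k}) \<and> (k > j \<longrightarrow> x \<in> {T k, ZE k})"
      if "k \<in> {1..m} - {j}" "x \<in> S \<inter> V k" for x k
      using blocks [OF that(1)] that(2) unfolding block_eq_singleton by blast
    have two: "card (S \<inter> V j) = 2"
      using j(2) by simp
    have Vj: "YL j \<in> S" "ZE j \<in> S" "T j \<notin> S" "YR j \<notin> S"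
      using j(2) by (auto simp: V_def)
    \<comment> \<open>The sides are exchanged: left arrows sit only up to \<open>j\<close> and
      \<open>ZE\<close> only from \<open>j\<close> on.\<close>
    have YL: "k \<le> j" if "YL k \<in> S" for k
      using that lo [of k "YL k"] range [of k]
      by (cases k j rule: linorder_cases) (simp_all add: V_def)
    have ZE: "j \<le> k" if "ZE k \<in> S" for k
      using that lo [of k "ZE k"] range [of k]
      by (cases k j rule: linorder_cases) (simp_all add: V_def)
    have YR: "YR k \<notin> S" for k
      using lo [of k "YR k"] range [of k] Vj
      by (cases k j rule: linorder_cases) (auto simp: V_def)
    have T: "T k \<in> S \<Longrightarrow> YL k \<notin> S \<and> ZE k \<notin> S" for k
      using one [of k] range [of k] Vj by (cases "k = j") (auto simp: card_block)
    have "\<not> (YL l \<in> S \<and> ZE k \<in> S)" if "k < l" for k l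
      using that YL [of l] ZE [of k] by linarith
    then have "is_face S"
      unfolding is_face_def using conjunct1 [OF conjunct2 [OF ii]] YR T by blast
    then show ?thesis
      using ii sum_block [OF j(1) two one] card_eq_sum_blocks [OF assms(2)] by simp
  qed
  moreover have "card S = m + 2 \<and> is_face S" if iii: ?iii
  proof -
    have one: "card (S \<inter> V k) = 1" and ZT: "\<And>x. x \<in> S \<inter> V k \<Longrightarrow> x \<in> {ZE k, T k}"
      if "k \<in> {1..m}" for k
      using iii that unfolding block_eq_singleton by blast+
    \<comment> \<open>Every forbidden pair except \<open>T k\<close>, \<open>ZE k\<close> contains
      an arrow, and that last pair would put two variables into one block.\<close>
    have "YR k \<notin> S" "YL k \<notin> S" for k
      using ZT [of k "YR k"] ZT [of k "YL k"] range [of k] by (auto simp: V_def)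
    moreover have "T k \<in> S \<Longrightarrow> ZE k \<notin> S" for k
      using one [of k] range [of k] by (auto simp: card_block)
    ultimately have "is_face S"
      unfolding is_face_def by blast
    then show ?thesis
      using iii one card_eq_sum_blocks [OF assms(2)] by simp
  qed
  ultimately show ?thesis
    unfolding facet by blast
qed

end
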